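(* For each $s \in \{1,-1\}$ and every function $d \mapsto n(d)$ from the positive integers to $\{3,4,5,\dots\}$ with $\lim_{d\to\infty} n(d)/d = 0$, one has $$\rho_{d,s,n(d)} \sim \sqrt{\frac{d}{2\pi}} \quad \text{as } d \to \infty,$$ that is, $\lim_{d\to\infty} \rho_{d,s,n(d)} \big/ \sqrt{d/(2\pi)} = 1$. Here $\rho_{d,s,n}$ denotes the optimal (smallest) value of $\rho$ in the sign uncertainty problem restricted to polynomials of degree at most $n$ times a Gaussian, as defined in the context.
   Context: The Fourier transform of an integrable function $f\colon \mathbb{R}^d \to \mathbb{C}$ is normalized by $\widehat{f}(y) = \int_{\mathbb{R}^d} f(x) e^{-2\pi i \langle x, y\rangle}\,dx$, and $|x|$ denotes the Euclidean norm. For a positive integer $d$, a sign $s \in \{1,-1\}$, and an integer $n \ge 3$, the number $\rho_{d,s,n}$ is the smallest real number $\rho \ge 0$ (formally, the infimum of all real numbers $\rho \ge 0$) for which there exists a function $f\colon \mathbb{R}^d \to \mathbb{R}$ of the form $f(x) = p(2\pi |x|^2) e^{-\pi |x|^2}$, with $p$ a single-variable polynomial with real coefficients of degree at most $n$, such that (1) $f$ is not identically zero, (2) $\widehat{f} = s f$, (3) $f(0) = 0$, and (4) $f(x) \ge 0$ whenever $|x| \ge \rho$. *)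

theory Defs
  imports "HOL-Analysis.Analysis" "HOL-Computational_Algebra.Polynomial"
begin

text \<open>
  The dimension varies inside the statement, so Euclidean space is represented by the extensional
  functions on \<open>{..<d}\<close>, with \<open>d\<close>-dimensional Lebesgue measure as the product measure of \<open>lborel\<close>;
  the Euclidean norm is \<open>L2_set x {..<d}\<close>.
\<close>

definition Rd :: "nat \<Rightarrow> (nat \<Rightarrow> real) set" where
  "Rd d = PiE {..<d} (\<lambda>_. UNIV)"

definition lborel_Rd :: "nat \<Rightarrow> (nat \<Rightarrow> real) measure" where
  "lborel_Rd d = PiM {..<d} (\<lambda>_. lborel)"

definition norm_Rd :: "nat \<Rightarrow> (nat \<Rightarrow> real) \<Rightarrow> real" where
  "norm_Rd d x = L2_set x {..<d}"

definition inner_Rd :: "nat \<Rightarrow> (nat \<Rightarrow> real) \<Rightarrow> (nat \<Rightarrow> real) \<Rightarrow> real" where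
  "inner_Rd d x y = (\<Sum>i<d. x i * y i)"

definition fourier :: "nat \<Rightarrow> ((nat \<Rightarrow> real) \<Rightarrow> complex) \<Rightarrow> (nat \<Rightarrow> real) \<Rightarrow> complex" where
  "fourier d f y =
     (LINT x|lborel_Rd d. f x * exp (- 2 * complex_of_real pi * \<i> * complex_of_real (inner_Rd d x y)))"

definition poly_gaussian :: "nat \<Rightarrow> nat \<Rightarrow> ((nat \<Rightarrow> real) \<Rightarrow> real) \<Rightarrow> bool" where
  "poly_gaussian d n f \<longleftrightarrow>
     (\<exists>p :: real poly. degree p \<le> n \<and>
        (\<forall>x\<in>Rd d. f x = poly p (2 * pi * (norm_Rd d x)\<^sup>2) * exp (- pi * (norm_Rd d x)\<^sup>2)))"

definition sign_admissible :: "nat \<Rightarrow> real \<Rightarrow> nat \<Rightarrow> real \<Rightarrow> ((nat \<Rightarrow> real) \<Rightarrow> real) \<Rightarrow> bool" where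
  "sign_admissible d s n \<rho> f \<longleftrightarrow>
     poly_gaussian d n f \<and>
     (\<exists>x\<in>Rd d. f x \<noteq> 0) \<and>
     (\<forall>y\<in>Rd d. fourier d (\<lambda>x. complex_of_real (f x)) y = complex_of_real (s * f y)) \<and>
     f (\<lambda>i\<in>{..<d}. 0) = 0 \<and>
     (\<forall>x\<in>Rd d. norm_Rd d x \<ge> \<rho> \<longrightarrow> f x \<ge> 0)"

text \<open>
  The set below is bounded below by 0, and for \<open>d \<ge> 1\<close>, \<open>s \<in> {1, -1}\<close>, \<open>n \<ge> 3\<close> it is nonempty: the
  Laguerre polynomials \<open>L\<^sub>k\<close> with parameter \<open>d / 2 - 1\<close>, taken at \<open>2 * pi * |x|\<^sup>2\<close> times the
  Gaussian, are eigenfunctions with eigenvalue \<open>(-1)^k\<close>, and a suitable combination of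
  \<open>k = 0, 2\<close> (resp. \<open>k = 1, 3\<close>) is admissible for large \<open>\<rho>\<close>. So the infimum is a genuine one.
\<close>

definition rho :: "nat \<Rightarrow> real \<Rightarrow> nat \<Rightarrow> real" where
  "rho d s n = Inf {\<rho>. \<rho> \<ge> 0 \<and> (\<exists>f. sign_admissible d s n \<rho> f)}"

end

theory Submission
  imports Defs "HOL-Probability.Characteristic_Functions"
    "HOL-Computational_Algebra.Fundamental_Theorem_Algebra"
begin

text \<open>
  Put \<open>t = 2 * pi * |x|\<^sup>2\<close>. Under the probability density \<open>exp (- pi * |x|\<^sup>2)\<close> the variable \<open>t\<close>
  is chi-squared distributed with \<open>d\<close> degrees of freedom, so its mean is \<open>d\<close>, and
  \<open>|x| = sqrt (d / (2 * pi))\<close> is exactly the radius where \<open>t = d\<close>. Write \<open>E p\<close> for the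
  expectation of \<open>p t\<close>.

  Lower bound. If \<open>f = p(t) * exp (- t / 2)\<close> is admissible, then its integral is
  \<open>E p\<close>, which is the value of the Fourier transform at the origin and therefore \<open>s * f(0) = 0\<close>.
  On the other hand \<open>p \<ge> 0\<close> on a half-line \<open>[T, \<infinity>)\<close>, so \<open>p\<close> is a sum of terms
  \<open>g\<^sup>2\<close> and \<open>(t - T) * g\<^sup>2\<close> (\<open>halfline_sos_of_nonneg\<close>). Hence \<open>E p > 0\<close>, a contradiction, as soon as
  \<open>E (t * g\<^sup>2) > T * E (g\<^sup>2)\<close> for all \<open>g \<noteq> 0\<close> of degree at most \<open>n / 2\<close>. Integration by
  parts gives \<open>E (t * g\<^sup>2) = d * E (g\<^sup>2) + 4 * E (t * g * g')\<close>, and the last term is small compared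
  with the first because of the Bernstein-type inequality \<open>2 * E (t * g'\<^sup>2) \<le> degree g * E (g\<^sup>2)\<close>
  (\<open>chi_sq_expect_pderiv_square_le\<close>). A Gaussian times a polynomial of degree \<open>o(d)\<close> thus cannot move
  the mean of \<open>t\<close> away from \<open>d\<close> to first order, and \<open>T \<ge> d * (1 - o(1))\<close>
  (\<open>sign_admissible_lower_bound\<close>).

  The inequality for the derivative is the statement that the negative of the Laguerre operator has eigenvalues
  \<open>0, 1, ..., m\<close> on polynomials of degree at most \<open>m\<close>. It is proved without
  eigenfunctions: the derivative, as a map from the inner product of dimension \<open>d\<close> to that of dimension
  \<open>d + 2\<close>, has the adjoint \<open>laguerre_raise\<close> up to a factor, the two satisfy a commutation relation as for the harmonic oscillator, and that relation
  carries the bound from degree \<open>m\<close> to degree \<open>m + 1\<close>.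

  Upper bound. Polynomials of degree two and three already suffice: subtract from the Laguerre polynomial
  of degree 2 (for \<open>s = 1\<close>) or 3 (for \<open>s = -1\<close>) the multiple of that of degree 0 or 1 that makes the
  difference vanish at \<open>0\<close>. The last sign change of the result is at \<open>t = d + O(1)\<close>
  (\<open>sign_admissible_extremal\<close>).

  Both halves use one computation, the Fourier transform of \<open>t ^ k * exp (- t / 2)\<close>
  (\<open>gauss_moment_fourier_eq\<close>). At the origin it gives the moments of the chi-squared law, in the form of
  the product in \<open>chi_sq_expect\<close>, and for \<open>k \<le> 3\<close> it verifies the eigenfunctions.
\<close>

section \<open>Fourier transforms of Gaussian radial moments\<close>

text \<open>
  With this scaling the Gaussian is \<open>exp (- t / 2)\<close> and the moments of \<open>t\<close> are products of integers.
\<close>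

definition sq_radius :: "nat \<Rightarrow> (nat \<Rightarrow> real) \<Rightarrow> real" where
  "sq_radius d x = 2 * pi * (norm_Rd d x)\<^sup>2"

definition wave :: "nat \<Rightarrow> (nat \<Rightarrow> real) \<Rightarrow> (nat \<Rightarrow> real) \<Rightarrow> complex" where
  "wave d y x = exp (- 2 * complex_of_real pi * \<i> * complex_of_real (inner_Rd d x y))"

lemma sq_radius_sum: "sq_radius d x = (\<Sum>i<d. 2 * pi * (x i)\<^sup>2)"
  by (simp add: sq_radius_def norm_Rd_def L2_set_def sum_nonneg sum_distrib_left)

lemma sq_radius_nonneg [simp]: "0 \<le> sq_radius d x"
  by (simp add: sq_radius_def)

lemma norm_wave [simp]: "norm (wave d y x) = 1"
  by (simp add: wave_def)

lemma space_lborel_Rd: "space (lborel_Rd d) = Rd d"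
  by (simp add: lborel_Rd_def Rd_def space_PiM)

lemma measurable_sq_radius [measurable]: "sq_radius d \<in> borel_measurable (lborel_Rd d)"
  unfolding sq_radius_sum[abs_def] lborel_Rd_def by measurable

lemma measurable_wave [measurable]: "wave d y \<in> borel_measurable (lborel_Rd d)"
  unfolding wave_def[abs_def] inner_Rd_def lborel_Rd_def by measurable

text \<open>
  The substitution \<open>x \<mapsto> sqrt (2 * pi * a) * x\<close> reduces this to the characteristic function of the
  standard normal distribution.
\<close>
lemma gaussian_fourier_1d:
  fixes a y :: real
  assumes a: "a > 0"
  defines "g \<equiv> \<lambda>x. complex_of_real (exp (- a * (2 * pi * x\<^sup>2) / 2)) *
                     exp (- 2 * complex_of_real pi * \<i> * complex_of_real (x * y))"
  shows "integrable lborel g"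
    and "(LINT x|lborel. g x) = complex_of_real (a powr (- 1 / 2) * exp (- (2 * pi * y\<^sup>2 / a) / 2))"
proof -
  define c where "c = sqrt (2 * pi * a)"
  have c: "c > 0" and c2: "c\<^sup>2 = 2 * pi * a" using a by (auto simp: c_def)
  define t where "t = - 2 * pi * y / c"
  define h where "h = (\<lambda>x. std_normal_density x *\<^sub>R iexp (t * x))"
  have h_int: "integrable lborel h"
  proof (rule Bochner_Integration.integrable_bound)
    show "integrable lborel std_normal_density" by simp
    show "h \<in> borel_measurable lborel" unfolding h_def by measurable
  qed (simp add: h_def)
  have h_val: "(LINT x|lborel. h x) = complex_of_real (exp (- (t\<^sup>2) / 2))"
    using fun_cong[OF char_std_normal_distribution, of t]
    unfolding char_def h_def by (subst (asm) integral_density) (auto simp: normal_density_nonneg)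
  have hc: "h (0 + c * x) = complex_of_real (1 / sqrt (2 * pi)) * g x" for x
  proof -
    have "- (c * x)\<^sup>2 / 2 = - a * (2 * pi * x\<^sup>2) / 2"
      by (simp add: power_mult_distrib c2)
    moreover have "\<i> * complex_of_real (t * (c * x))
        = - 2 * complex_of_real pi * \<i> * complex_of_real (x * y)"
    proof -
      have "t * (c * x) = - 2 * pi * (x * y)" using c by (simp add: t_def)
      then show ?thesis by (simp only:) simp
    qed
    ultimately show ?thesis
      unfolding h_def g_def std_normal_density_def scaleR_conv_of_real add_0_left of_real_mult[of "1 / _"]
      by (simp only: mult.assoc)
  qed
  have g_h: "g = (\<lambda>x. complex_of_real (sqrt (2 * pi)) * h (0 + c * x))"
    unfolding hc by (simp add: fun_eq_iff flip: of_real_mult)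
  show "integrable lborel g"
    unfolding g_h using lborel_integrable_real_affine[OF h_int, of c 0] c by simp
  have "(LINT x|lborel. h x) = \<bar>c\<bar> *\<^sub>R (LINT x|lborel. h (0 + c * x))"
    using c by (intro lborel_integral_real_affine) simp
  also have "(LINT x|lborel. h (0 + c * x)) = complex_of_real (1 / sqrt (2 * pi)) * (LINT x|lborel. g x)"
    unfolding hc by simp
  finally have *: "complex_of_real (exp (- (t\<^sup>2) / 2))
      = complex_of_real (c / sqrt (2 * pi)) * (LINT x|lborel. g x)"
    using c h_val by (simp add: scaleR_conv_of_real)
  have "c / sqrt (2 * pi) = sqrt a" by (simp add: c_def real_sqrt_mult)
  moreover have "t\<^sup>2 = 2 * pi * y\<^sup>2 / a"
    using a by (simp add: t_def power_divide power_mult_distrib c2) (simp add: field_simps power2_eq_square)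
  moreover have "a powr (- 1 / 2) = 1 / sqrt a"
    using a by (simp add: powr_minus_divide powr_half_sqrt)
  ultimately have "complex_of_real (a powr (- 1 / 2) * exp (- (2 * pi * y\<^sup>2 / a) / 2))
      = complex_of_real (1 / sqrt a) * (complex_of_real (sqrt a) * (LINT x|lborel. g x))"
    using * by simp
  also have "\<dots> = (LINT x|lborel. g x)"
    using a by (simp flip: mult.assoc of_real_mult)
  finally show "(LINT x|lborel. g x)
      = complex_of_real (a powr (- 1 / 2) * exp (- (2 * pi * y\<^sup>2 / a) / 2))" ..
qed

text \<open>
  The width parameter \<open>a\<close> is there to be differentiated: each derivative in \<open>a\<close> brings down a
  factor \<open>- t / 2\<close>.
\<close>
definition gauss_moment_fourier :: "nat \<Rightarrow> nat \<Rightarrow> (nat \<Rightarrow> real) \<Rightarrow> real \<Rightarrow> complex" where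
  "gauss_moment_fourier d k y a =
     (LINT x|lborel_Rd d. complex_of_real (sq_radius d x ^ k * exp (- a * sq_radius d x / 2)) * wave d y x)"

text \<open>
  The integrand is a product over the coordinates.
\<close>
lemma gaussian_fourier:
  fixes a :: real
  assumes a: "a > 0"
  shows "integrable (lborel_Rd d) (\<lambda>x. complex_of_real (exp (- a * sq_radius d x / 2)) * wave d y x)"
      (is "integrable _ ?f")
    and "gauss_moment_fourier d 0 y a
           = complex_of_real (a powr (- (real d / 2)) * exp (- (sq_radius d y / a) / 2))"
proof -
  interpret product_sigma_finite "\<lambda>_::nat. lborel :: real measure" ..
  define g where "g i x = complex_of_real (exp (- a * (2 * pi * x\<^sup>2) / 2)) *
                     exp (- 2 * complex_of_real pi * \<i> * complex_of_real (x * y i))" for i :: nat and x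
  have f: "?f = (\<lambda>x. \<Prod>i<d. g i (x i))"
    by (simp add: fun_eq_iff g_def wave_def inner_Rd_def sq_radius_sum prod.distrib
        flip: exp_sum of_real_prod exp_of_real)
       (simp add: sum_distrib_left sum_divide_distrib sum_negf mult_ac)
  show "integrable (lborel_Rd d) ?f"
    unfolding f lborel_Rd_def g_def
    by (intro product_integrable_prod gaussian_fourier_1d a) auto
  have "gauss_moment_fourier d 0 y a = (LINT x|lborel_Rd d. ?f x)"
    by (simp add: gauss_moment_fourier_def)
  also have "\<dots> = (\<Prod>i<d. LINT x|lborel. g i x)"
    unfolding f lborel_Rd_def
    by (rule product_integral_prod) (auto simp: g_def intro!: gaussian_fourier_1d(1)[OF a, simplified])
  also have "\<dots> = (\<Prod>i<d. complex_of_real (a powr (- 1 / 2) * exp (- (2 * pi * (y i)\<^sup>2 / a) / 2)))"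
    unfolding g_def gaussian_fourier_1d(2)[OF a] ..
  also have "\<dots> = complex_of_real ((a powr (- 1 / 2)) ^ d * exp (\<Sum>i<d. - (2 * pi * (y i)\<^sup>2 / a) / 2))"
    by (simp add: prod.distrib exp_sum)
  also have "(a powr (- 1 / 2)) ^ d = a powr (- (real d / 2))"
    using a by (simp add: powr_realpow[symmetric] powr_powr)
  also have "(\<Sum>i<d. - (2 * pi * (y i)\<^sup>2 / a) / 2) = - (sq_radius d y / a) / 2"
    by (simp add: sq_radius_sum sum_negf sum_divide_distrib)
  finally show "gauss_moment_fourier d 0 y a
           = complex_of_real (a powr (- (real d / 2)) * exp (- (sq_radius d y / a) / 2))" .
qed

lemma power_le_fact_exp:
  fixes x :: real
  assumes "x \<ge> 0"
  shows "x ^ k \<le> fact k * exp x"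
proof -
  have "(\<Sum>n\<in>{k}. x ^ n /\<^sub>R fact n) \<le> (\<Sum>n. x ^ n /\<^sub>R fact n)"
    using assms by (intro sum_le_suminf summable_exp_generic) auto
  then show ?thesis by (simp add: exp_def field_simps)
qed

text \<open>
  Half of the exponential decay absorbs the power: \<open>t ^ k\<close> is at most a constant times
  \<open>exp (a * t / 4)\<close>.
\<close>
lemma integrable_gauss_moment:
  assumes a: "a > 0"
  shows "integrable (lborel_Rd d) (\<lambda>x. sq_radius d x ^ k * exp (- a * sq_radius d x / 2))"
proof (rule Bochner_Integration.integrable_bound)
  have "integrable (lborel_Rd d)
      (\<lambda>x. norm (complex_of_real (exp (- (a / 2) * sq_radius d x / 2)) * wave d y x))" for y
    using a by (intro integrable_norm gaussian_fourier) auto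
  then have "integrable (lborel_Rd d) (\<lambda>x. exp (- (a / 2) * sq_radius d x / 2))"
    by (simp add: norm_mult)
  then show "integrable (lborel_Rd d)
      (\<lambda>x. (fact k * (4 / a) ^ k) * exp (- (a / 2) * sq_radius d x / 2))"
    by (rule integrable_mult_right)
  show "AE x in lborel_Rd d. norm (sq_radius d x ^ k * exp (- a * sq_radius d x / 2))
          \<le> norm ((fact k * (4 / a) ^ k) * exp (- (a / 2) * sq_radius d x / 2))"
  proof (rule AE_I2)
    fix x
    let ?t = "sq_radius d x"
    have "(a * ?t / 4) ^ k \<le> fact k * exp (a * ?t / 4)"
      using a by (intro power_le_fact_exp) simp
    then have "(4 / a) ^ k * (a * ?t / 4) ^ k \<le> (4 / a) ^ k * (fact k * exp (a * ?t / 4))"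
      using a by (intro mult_left_mono) auto
    also have "(4 / a) ^ k * (a * ?t / 4) ^ k = ?t ^ k"
      using a by (simp flip: power_mult_distrib)
    finally have "?t ^ k * exp (- a * ?t / 2)
        \<le> ((4 / a) ^ k * (fact k * exp (a * ?t / 4))) * exp (- a * ?t / 2)"
      by (rule mult_right_mono) simp
    also have "\<dots> = (fact k * (4 / a) ^ k) * (exp (a * ?t / 4) * exp (- a * ?t / 2))"
      by (simp only: mult_ac)
    also have "exp (a * ?t / 4) * exp (- a * ?t / 2) = exp (- (a / 2) * ?t / 2)"
      by (simp flip: exp_add)
    finally show "norm (?t ^ k * exp (- a * ?t / 2))
          \<le> norm ((fact k * (4 / a) ^ k) * exp (- (a / 2) * ?t / 2))"
      using a by simp
  qed
qed measurable

lemma integrable_gauss_moment_wave: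
  assumes "a > 0"
  shows "integrable (lborel_Rd d)
    (\<lambda>x. complex_of_real (sq_radius d x ^ k * exp (- a * sq_radius d x / 2)) * wave d y x)"
proof (rule Bochner_Integration.integrable_bound[OF integrable_gauss_moment[OF assms, of d k]])
  show "AE x in lborel_Rd d.
    norm (complex_of_real (sq_radius d x ^ k * exp (- a * sq_radius d x / 2)) * wave d y x)
      \<le> norm (sq_radius d x ^ k * exp (- a * sq_radius d x / 2))"
    by (simp only: norm_mult norm_of_real norm_wave) simp
qed measurable

lemma exp_quadratic_error:
  fixes w :: real
  shows "\<bar>exp w - 1 - w\<bar> \<le> w\<^sup>2 * exp \<bar>w\<bar>"
proof -
  obtain t where t: "\<bar>t\<bar> \<le> \<bar>w\<bar>" "exp w = (\<Sum>m<2. w ^ m / fact m) + exp t / fact 2 * w ^ 2"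
    using Maclaurin_exp_le by blast
  then have "exp w - 1 - w = (exp t / 2) * w\<^sup>2"
    by (simp add: numeral_2_eq_2)
  also have "\<bar>\<dots>\<bar> \<le> exp \<bar>w\<bar> * w\<^sup>2"
  proof -
    have "exp t \<le> exp \<bar>w\<bar>" using t(1) by simp
    then have "exp t / 2 \<le> exp \<bar>w\<bar>" using exp_gt_zero[of t] by linarith
    then have "exp t / 2 * w\<^sup>2 \<le> exp \<bar>w\<bar> * w\<^sup>2" by (rule mult_right_mono) simp
    then show ?thesis by simp
  qed
  finally show ?thesis by (simp add: mult.commute)
qed

text \<open>
  Differentiation under the integral sign. Instead of dominated convergence, the remainder
  of the first-order expansion of \<open>exp (- h * t / 2)\<close> is bounded by \<open>h\<^sup>2 * t\<^sup>2 * exp (a * t / 4)\<close>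
  for \<open>\<bar>h\<bar> \<le> a / 2\<close>, which is integrable against the remaining Gaussian factor and makes the total error
  \<open>O(h\<^sup>2)\<close>.
\<close>
lemma gauss_moment_fourier_derivative:
  assumes a: "a > 0"
  shows "(gauss_moment_fourier d k y has_vector_derivative
            (- 1 / 2) *\<^sub>R gauss_moment_fourier d (Suc k) y a) (at a)"
proof -
  define C where "C = (LINT x|lborel_Rd d. sq_radius d x ^ (k + 2) * exp (- (a / 2) * sq_radius d x / 2))"
  let ?F = "gauss_moment_fourier d k y" and ?G = "(- 1 / 2) *\<^sub>R gauss_moment_fourier d (Suc k) y a"
  let ?f = "\<lambda>k a x. complex_of_real (sq_radius d x ^ k * exp (- a * sq_radius d x / 2)) * wave d y x"
  have bound: "norm (?F (a + h) - ?F a - h *\<^sub>R ?G) \<le> h\<^sup>2 * C" if h: "\<bar>h\<bar> \<le> a / 2" for h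
  proof -
    have ah: "a + h > 0" using h a by linarith
    have split: "?F (a + h) - ?F a - h *\<^sub>R ?G
        = (LINT x|lborel_Rd d. ?f k (a + h) x - ?f k a x - h *\<^sub>R (- 1 / 2) *\<^sub>R ?f (Suc k) a x)"
      unfolding gauss_moment_fourier_def integral_scaleR_right[symmetric]
      using integrable_gauss_moment_wave[OF a] integrable_gauss_moment_wave[OF ah]
      by (subst Bochner_Integration.integral_diff[symmetric];
          (intro Bochner_Integration.integrable_diff integrable_scaleR_right)?; (simp only:)?)+
    have "norm (LINT x|lborel_Rd d. ?f k (a + h) x - ?f k a x - h *\<^sub>R (- 1 / 2) *\<^sub>R ?f (Suc k) a x)
        \<le> (LINT x|lborel_Rd d. h\<^sup>2 * (sq_radius d x ^ (k + 2) * exp (- (a / 2) * sq_radius d x / 2)))"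
    proof (rule order_trans[OF integral_norm_bound integral_mono[OF integrable_norm]])
      show "integrable (lborel_Rd d)
        (\<lambda>x. ?f k (a + h) x - ?f k a x - h *\<^sub>R (- 1 / 2) *\<^sub>R ?f (Suc k) a x)"
        using integrable_gauss_moment_wave[OF a] integrable_gauss_moment_wave[OF ah]
        by (intro Bochner_Integration.integrable_diff integrable_scaleR_right)
      show "integrable (lborel_Rd d)
        (\<lambda>x. h\<^sup>2 * (sq_radius d x ^ (k + 2) * exp (- (a / 2) * sq_radius d x / 2)))"
        using a by (intro integrable_mult_right integrable_gauss_moment) simp
      fix x
      let ?t = "sq_radius d x"
      define w where "w = - h * ?t / 2"
      have e: "exp (- (a + h) * ?t / 2) = exp (- a * ?t / 2) * exp w"
        by (simp add: w_def field_simps flip: exp_add)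
      have factor: "?f k (a + h) x - ?f k a x - h *\<^sub>R (- 1 / 2) *\<^sub>R ?f (Suc k) a x
          = complex_of_real (?t ^ k * exp (- a * ?t / 2) * (exp w - 1 - w)) * wave d y x"
        unfolding e by (simp add: w_def scaleR_conv_of_real algebra_simps)
      have "norm (complex_of_real (?t ^ k * exp (- a * ?t / 2) * (exp w - 1 - w)) * wave d y x)
          = ?t ^ k * exp (- a * ?t / 2) * \<bar>exp w - 1 - w\<bar>"
        by (simp only: norm_mult norm_of_real norm_wave abs_mult) simp
      also have "\<dots> \<le> ?t ^ k * exp (- a * ?t / 2) * (w\<^sup>2 * exp \<bar>w\<bar>)"
        by (intro mult_left_mono exp_quadratic_error) simp
      also have "\<dots> = (?t ^ k * w\<^sup>2) * (exp (- a * ?t / 2) * exp \<bar>w\<bar>)"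
        by (simp only: mult_ac)
      also have "\<dots> \<le> (h\<^sup>2 * ?t ^ (k + 2)) * exp (- (a / 2) * ?t / 2)"
      proof (rule mult_mono)
        show "?t ^ k * w\<^sup>2 \<le> h\<^sup>2 * ?t ^ (k + 2)"
        proof -
          have "?t ^ k * w\<^sup>2 = h\<^sup>2 * ?t ^ (k + 2) / 4"
            by (simp add: w_def power_mult_distrib power_divide power_add power2_eq_square)
          also have "\<dots> \<le> h\<^sup>2 * ?t ^ (k + 2)"
            using zero_le_mult_iff[of "h\<^sup>2" "?t ^ (k + 2)"] by simp
          finally show ?thesis .
        qed
        have "\<bar>w\<bar> \<le> a / 2 * ?t / 2"
          unfolding w_def using mult_right_mono[OF h, of ?t] by (simp add: abs_mult)
        then show "exp (- a * ?t / 2) * exp \<bar>w\<bar> \<le> exp (- (a / 2) * ?t / 2)"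
          by (simp flip: exp_add)
      qed auto
      finally show "norm (?f k (a + h) x - ?f k a x - h *\<^sub>R (- 1 / 2) *\<^sub>R ?f (Suc k) a x)
          \<le> h\<^sup>2 * (?t ^ (k + 2) * exp (- (a / 2) * ?t / 2))"
        unfolding factor by (simp only: mult.assoc)
    qed
    also have "\<dots> = h\<^sup>2 * C"
      unfolding C_def by (rule integral_mult_right_zero)
    finally show ?thesis unfolding split .
  qed
  have "((\<lambda>h. norm (?F (a + h) - ?F a - h *\<^sub>R ?G) / norm h) \<longlongrightarrow> 0) (at 0)"
  proof (rule tendsto_sandwich[where f = "\<lambda>_. 0" and h = "\<lambda>h. \<bar>h\<bar> * C"])
    show "\<forall>\<^sub>F h in at 0. norm (?F (a + h) - ?F a - h *\<^sub>R ?G) / norm h \<le> \<bar>h\<bar> * C"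
    proof -
      have "norm (?F (a + h) - ?F a - h *\<^sub>R ?G) / norm h \<le> \<bar>h\<bar> * C"
        if "h \<noteq> 0" "dist h 0 < a / 2" for h
      proof -
        have "norm (?F (a + h) - ?F a - h *\<^sub>R ?G) \<le> h\<^sup>2 * C"
          using that by (intro bound) auto
        also have "h\<^sup>2 * C = (\<bar>h\<bar> * C) * norm h"
          by (subst power2_abs[symmetric]) (simp only: power2_eq_square real_norm_def mult_ac)
        finally show ?thesis using that by (simp only: pos_divide_le_eq zero_less_norm_iff simp_thms)
      qed
      then show ?thesis
        using a by (auto simp: eventually_at intro!: exI[of _ "a / 2"])
    qed
    show "((\<lambda>h. \<bar>h\<bar> * C) \<longlongrightarrow> 0) (at 0)"
      by (auto intro!: tendsto_eq_intros)
  qed auto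
  then show ?thesis
    unfolding has_vector_derivative_def has_derivative_at
    by (intro conjI bounded_linear_scaleR_left)
qed

text \<open>
  The polynomial \<open>Q\<close> for which \<open>Q(u) * exp (- u / 2)\<close> is the Fourier transform of
  \<open>t ^ k * exp (- t / 2)\<close>, where \<open>u\<close> is the value of \<open>t\<close> at the frequency; up to normalization
  it is the Laguerre polynomial with parameter \<open>d / 2 - 1\<close> in the variable \<open>u / 2\<close>.
\<close>
fun gauss_transform :: "nat \<Rightarrow> nat \<Rightarrow> real poly" where
  "gauss_transform d 0 = 1"
| "gauss_transform d (Suc k) = [:real (d + 2 * k), - 1:] * gauss_transform d k
     + [:0, 2:] * pderiv (gauss_transform d k)"

text \<open>
  The recursion for \<open>gauss_transform\<close> is what comes out when the formula for \<open>k\<close> is differentiated in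
  \<open>a\<close>: the three terms are the derivatives of the power of \<open>a\<close>, of the polynomial in \<open>u / a\<close> and
  of the exponential.
\<close>
lemma gauss_moment_fourier_eq:
  assumes "a > 0"
  shows "gauss_moment_fourier d k y a = complex_of_real
    (a powr (- (real d / 2 + real k)) * poly (gauss_transform d k) (sq_radius d y / a)
       * exp (- (sq_radius d y / a) / 2))"
  using assms
proof (induction k arbitrary: a)
  case 0
  then show ?case using gaussian_fourier(2)[OF 0, of d y] by simp
next
  case (Suc k)
  note a = \<open>a > 0\<close>
  let ?u = "sq_radius d y" and ?Q = "gauss_transform d k" and ?b = "real d / 2 + real k"
  let ?R = "\<lambda>a. a powr (- ?b) * poly ?Q (?u / a) * exp (- (?u / a) / 2)"
  define D where "D = (- 1 / 2) * (a powr (- ?b - 1) * poly (gauss_transform d (Suc k)) (?u / a)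
       * exp (- (?u / a) / 2))"
  have "((\<lambda>a. ?u / a) has_real_derivative - (?u / a\<^sup>2)) (at a)"
    using a by (auto intro!: derivative_eq_intros simp: power2_eq_square)
  note d = this
  have d_poly: "((\<lambda>a. poly ?Q (?u / a)) has_real_derivative
      - (?u / a\<^sup>2) * poly (pderiv ?Q) (?u / a)) (at a)"
    using DERIV_chain2[OF poly_DERIV d] by (simp add: mult.commute)
  have d_exp: "((\<lambda>a. exp (- (?u / a) / 2)) has_real_derivative
      ?u / a\<^sup>2 / 2 * exp (- (?u / a) / 2)) (at a)"
    using DERIV_fun_exp[OF DERIV_cdivide[OF DERIV_minus[OF d], of 2]] by (simp add: mult.commute)
  have d_powr: "((\<lambda>a. a powr (- ?b)) has_real_derivative - ?b * a powr (- ?b - 1)) (at a)"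
    using a by (rule has_real_derivative_powr)
  have powr: "a powr (- ?b) = a * a powr (- ?b - 1)"
    using a by (simp add: powr_diff)
  define P q q' e where "P = a powr (- ?b - 1)" and "q = poly ?Q (?u / a)"
    and "q' = poly (pderiv ?Q) (?u / a)" and "e = exp (- (?u / a) / 2)"
  note abbrev = P_def[symmetric] q_def[symmetric] q'_def[symmetric] e_def[symmetric]
  have "D = - 1 / 2 * (P * ((2 * ?b - ?u / a) * q + 2 * (?u / a) * q') * e)"
    unfolding D_def abbrev by (simp add: q_def q'_def algebra_simps)
  also have "\<dots> = (- ?b * P * q + - (?u / a\<^sup>2) * q' * (a * P)) * e
      + ?u / a\<^sup>2 / 2 * e * (a * P * q)"
    using a by (simp add: field_simps power2_eq_square)
  finally have "(- ?b * P * q + - (?u / a\<^sup>2) * q' * (a * P)) * e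
      + ?u / a\<^sup>2 / 2 * e * (a * P * q) = D" ..
  with DERIV_mult[OF DERIV_mult[OF d_powr d_poly] d_exp]
  have "(?R has_real_derivative D) (at a)"
    unfolding powr abbrev by (simp only:)
  then have "((\<lambda>a. complex_of_real (?R a)) has_vector_derivative complex_of_real D) (at a)"
    by (intro has_vector_derivative_of_real) (simp add: has_real_derivative_iff_has_vector_derivative)
  then have "(gauss_moment_fourier d k y has_vector_derivative complex_of_real D) (at a)"
    by (rule has_vector_derivative_transform_within_open[of _ _ _ "{0<..}"]) (use a Suc.IH in auto)
  with gauss_moment_fourier_derivative[OF a, of d k y]
  have "(- 1 / 2) *\<^sub>R gauss_moment_fourier d (Suc k) y a = complex_of_real D"
    using vector_derivative_unique_at by blast
  then have "gauss_moment_fourier d (Suc k) y a = complex_of_real (- 2 * D)"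
    by (simp add: scaleR_conv_of_real field_simps) (metis add.inverse_inverse)
  also have "- 2 * D = a powr (- ?b - 1) * poly (gauss_transform d (Suc k)) (?u / a)
      * exp (- (?u / a) / 2)"
    by (simp only: D_def)
  also have "- ?b - 1 = - (real d / 2 + real (Suc k))" by simp
  finally show ?case .
qed

section \<open>Chi-squared expectations of polynomials\<close>

text \<open>
  The moment of order \<open>k\<close> of the chi-squared law with \<open>d\<close> degrees of freedom is
  \<open>d * (d + 2) * ... * (d + 2 * k - 2)\<close>. An algebraic definition lets identities between different
  dimensions be proved by induction on the polynomial.
\<close>

definition chi_sq_expect :: "nat \<Rightarrow> real poly \<Rightarrow> real" where
  "chi_sq_expect d p = (\<Sum>k\<le>degree p. coeff p k * (\<Prod>i<k. real (d + 2 * i)))"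

lemma chi_sq_expect_0 [simp]: "chi_sq_expect d 0 = 0"
  by (simp add: chi_sq_expect_def)

text \<open>
  Multiplying the integrand by \<open>t\<close> turns the chi-squared density for \<open>d\<close> into \<open>d\<close> times the one for
  \<open>d + 2\<close>. All properties of the expectation below are consequences of this rule.
\<close>
lemma chi_sq_expect_pCons [simp]:
  "chi_sq_expect d (pCons a p) = a + real d * chi_sq_expect (d + 2) p"
proof (cases "p = 0")
  case True
  then show ?thesis by (simp add: chi_sq_expect_def)
next
  case False
  have *: "(\<Prod>i<Suc k. real (d + 2 * i)) = real d * (\<Prod>i<k. real (d + 2 + 2 * i))" for k
    by (subst prod.lessThan_Suc_shift) (simp add: add_ac)
  have "chi_sq_expect d (pCons a p)
        = a + (\<Sum>k\<le>degree p. coeff p k * (\<Prod>i<Suc k. real (d + 2 * i)))"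
    using False unfolding chi_sq_expect_def
    by (simp add: sum.atMost_Suc_shift del: prod.lessThan_Suc sum.atMost_Suc)
  also have "\<dots> = a + real d * chi_sq_expect (d + 2) p"
    unfolding chi_sq_expect_def * by (simp add: sum_distrib_left mult_ac)
  finally show ?thesis .
qed

lemma chi_sq_expect_add: "chi_sq_expect d (p + q) = chi_sq_expect d p + chi_sq_expect d q"
proof (induction p q arbitrary: d rule: poly_induct2)
  case 0
  then show ?case by simp
next
  case (pCons a p b q)
  then show ?case by (simp add: algebra_simps)
qed

lemma chi_sq_expect_smult: "chi_sq_expect d (smult c p) = c * chi_sq_expect d p"
  by (induction p arbitrary: d) (auto simp: algebra_simps)

lemma chi_sq_expect_diff: "chi_sq_expect d (p - q) = chi_sq_expect d p - chi_sq_expect d q"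
  using chi_sq_expect_add[of d "p - q" q] by simp

text \<open>
  Multiplied by \<open>d\<close>, this is integration by parts against the density
  proportional to \<open>t powr (d / 2 - 1) * exp (- t / 2)\<close>.
\<close>
lemma chi_sq_expect_by_parts:
  "chi_sq_expect (d + 2) p = chi_sq_expect d p + 2 * chi_sq_expect (d + 2) (pderiv p)"
proof (induction p arbitrary: d)
  case 0
  then show ?case by simp
next
  case (pCons a p)
  show ?case
    using pCons.IH[of "d + 2"]
    by (simp add: pderiv_pCons chi_sq_expect_add algebra_simps)
qed

text \<open>
  At frequency zero the transform is the integral, so these values are the moments.
\<close>
lemma poly_gauss_transform_0: "poly (gauss_transform d k) 0 = (\<Prod>i<k. real (d + 2 * i))"
  by (induction k) (simp_all add: mult.commute)

lemma fourier_poly_gaussian: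
  "fourier d (\<lambda>x. complex_of_real (poly p (sq_radius d x) * exp (- sq_radius d x / 2))) y
     = complex_of_real ((\<Sum>k\<le>degree p. coeff p k * poly (gauss_transform d k) (sq_radius d y))
         * exp (- sq_radius d y / 2))"
proof -
  let ?f = "\<lambda>k x. complex_of_real (sq_radius d x ^ k * exp (- 1 * sq_radius d x / 2)) * wave d y x"
  have "complex_of_real (poly p (sq_radius d x) * exp (- sq_radius d x / 2)) * wave d y x
      = (\<Sum>k\<le>degree p. complex_of_real (coeff p k) * ?f k x)" for x
    by (simp add: poly_altdef sum_distrib_right sum_distrib_left mult_ac)
  then have "fourier d (\<lambda>x. complex_of_real (poly p (sq_radius d x) * exp (- sq_radius d x / 2))) y
      = (LINT x|lborel_Rd d. (\<Sum>k\<le>degree p. complex_of_real (coeff p k) * ?f k x))"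
    unfolding fourier_def wave_def[symmetric] by simp
  also have "\<dots> = (\<Sum>k\<le>degree p. LINT x|lborel_Rd d. complex_of_real (coeff p k) * ?f k x)"
    by (intro Bochner_Integration.integral_sum integrable_mult_right integrable_gauss_moment_wave) simp
  also have "\<dots> = (\<Sum>k\<le>degree p. complex_of_real (coeff p k) * gauss_moment_fourier d k y 1)"
    unfolding gauss_moment_fourier_def by (intro sum.cong refl integral_mult_right_zero)
  also have "\<dots> = complex_of_real (\<Sum>k\<le>degree p. coeff p k *
      (poly (gauss_transform d k) (sq_radius d y) * exp (- sq_radius d y / 2)))"
    by (simp add: gauss_moment_fourier_eq)
  finally show ?thesis by (simp only: sum_distrib_right mult.assoc)
qed

text \<open>
  This is where the algebraic functional meets Lebesgue measure; it makes the functional positive on squares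
  and makes it vanish on the polynomial of an admissible function.
\<close>
lemma fourier_poly_gaussian_origin:
  assumes "\<And>i. i < d \<Longrightarrow> y i = 0"
  shows "fourier d (\<lambda>x. complex_of_real (poly p (sq_radius d x) * exp (- sq_radius d x / 2))) y
           = complex_of_real (chi_sq_expect d p)"
  using assms unfolding fourier_poly_gaussian
  by (simp add: sq_radius_sum chi_sq_expect_def poly_gauss_transform_0)

lemma chi_sq_expect_square_nonneg: "0 \<le> chi_sq_expect d (q * q)"
proof -
  have "complex_of_real (chi_sq_expect d (q * q)) = complex_of_real
      (LINT x|lborel_Rd d. poly (q * q) (sq_radius d x) * exp (- sq_radius d x / 2))"
    unfolding fourier_poly_gaussian_origin[of d "\<lambda>_. 0", symmetric, OF refl] fourier_def inner_Rd_def
    by (simp flip: of_real_mult integral_complex_of_real)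
  then have "chi_sq_expect d (q * q)
      = (LINT x|lborel_Rd d. poly (q * q) (sq_radius d x) * exp (- sq_radius d x / 2))"
    by (simp only: of_real_eq_iff)
  then show ?thesis
    by (simp add: Bochner_Integration.integral_nonneg)
qed

section \<open>A Bernstein inequality for the derivative\<close>

text \<open>
  The adjoint of \<open>pderiv\<close>, up to a factor, from the inner product of dimension \<open>d + 2\<close> to
  that of dimension \<open>d\<close>. Following \<open>pderiv\<close> by it gives the negative of the Laguerre differential
  operator in the variable \<open>t / 2\<close>; iterated on \<open>1\<close> with decreasing \<open>d\<close> it produces the Laguerre polynomials
  in that variable, as in the Rodrigues formula.
\<close>

definition laguerre_raise :: "nat \<Rightarrow> real poly \<Rightarrow> real poly" where
  "laguerre_raise d v = pCons 0 v - smult (real d) v - smult 2 (pCons 0 (pderiv v))"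

lemma laguerre_raise_adjoint:
  "chi_sq_expect d (u * laguerre_raise d v) = 2 * real d * chi_sq_expect (d + 2) (pderiv u * v)"
proof -
  have "u * laguerre_raise d v
      = pCons 0 (u * v) - smult (real d) (u * v) - smult 2 (pCons 0 (u * pderiv v))"
    by (simp add: laguerre_raise_def right_diff_distrib)
  then have "chi_sq_expect d (u * laguerre_raise d v)
      = real d * chi_sq_expect (d + 2) (u * v) - real d * chi_sq_expect d (u * v)
        - 2 * (real d * chi_sq_expect (d + 2) (u * pderiv v))"
    by (simp add: chi_sq_expect_diff chi_sq_expect_smult)
  also have "\<dots> = 2 * real d * chi_sq_expect (d + 2) (pderiv u * v)"
    by (subst chi_sq_expect_by_parts) (simp add: pderiv_mult chi_sq_expect_add algebra_simps)
  finally show ?thesis .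
qed

text \<open>
  The commutation relation of raising and lowering operators, here with a shift of the dimension: exchanging
  the two costs one copy of the identity. Each degree therefore adds \<open>1\<close> to the constant in
  the bounds below.
\<close>
lemma pderiv_laguerre_raise:
  "pderiv (laguerre_raise d v) = v + laguerre_raise (d + 2) (pderiv v)"
proof -
  have "poly (pderiv (laguerre_raise d v)) x = poly (v + laguerre_raise (d + 2) (pderiv v)) x" for x
    unfolding laguerre_raise_def pderiv_diff pderiv_smult pderiv_pCons
    by (simp add: algebra_simps)
  then show ?thesis by (simp add: poly_eq_poly_eq_iff[symmetric] fun_eq_iff)
qed

lemma linear_combination_square:
  fixes p q :: "real poly"
  shows "(smult a p + smult b q) * (smult a p + smult b q)
           = smult (a\<^sup>2) (p * p) + smult (2 * a * b) (p * q) + smult (b\<^sup>2) (q * q)"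
  by (subst poly_eq_poly_eq_iff[symmetric], rule ext)
     (simp add: algebra_simps power2_eq_square)

text \<open>
  By adjointness and the commutation relation the squared norm of the raised polynomial is that of \<open>v\<close>
  plus that of its derivative, which is how a bound for the derivative in dimension \<open>d + 2\<close> becomes a
  bound for the adjoint in dimension \<open>d\<close>.
\<close>
lemma laguerre_raise_square_le:
  assumes "2 * real (d + 2) * chi_sq_expect (d + 4) (pderiv v * pderiv v)
             \<le> c * chi_sq_expect (d + 2) (v * v)"
  shows "chi_sq_expect d (laguerre_raise d v * laguerre_raise d v)
           \<le> 2 * real d * ((1 + c) * chi_sq_expect (d + 2) (v * v))"
proof -
  have "chi_sq_expect d (laguerre_raise d v * laguerre_raise d v)
      = 2 * real d * chi_sq_expect (d + 2) (pderiv (laguerre_raise d v) * v)"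
    by (rule laguerre_raise_adjoint)
  also have "pderiv (laguerre_raise d v) * v = v * v + v * laguerre_raise (d + 2) (pderiv v)"
    by (simp add: pderiv_laguerre_raise algebra_simps)
  also have "chi_sq_expect (d + 2) \<dots> = chi_sq_expect (d + 2) (v * v)
      + 2 * real (d + 2) * chi_sq_expect (d + 4) (pderiv v * pderiv v)"
    by (simp add: chi_sq_expect_add laguerre_raise_adjoint numeral_eq_Suc)
  also have "\<dots> \<le> (1 + c) * chi_sq_expect (d + 2) (v * v)"
    using assms by (simp add: algebra_simps)
  finally show ?thesis by (simp add: mult_left_mono)
qed

text \<open>
  An operator and its adjoint have the same norm, so the bound for \<open>laguerre_raise\<close> on degree \<open>m\<close>
  gives one for \<open>pderiv\<close> on degree \<open>m + 1\<close>. The duality argument is carried out by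
  expanding a single nonnegative square.
\<close>
lemma chi_sq_expect_pderiv_square_le:
  "degree q \<le> m \<Longrightarrow>
     2 * real d * chi_sq_expect (d + 2) (pderiv q * pderiv q) \<le> real m * chi_sq_expect d (q * q)"
proof (induction m arbitrary: d q)
  case 0
  then have "pderiv q = 0" by (simp add: pderiv_eq_0_iff)
  then show ?case by simp
next
  case (Suc m)
  let ?v = "pderiv q" and ?w = "laguerre_raise d (pderiv q)"
  define N where "N = 2 * real d * chi_sq_expect (d + 2) (?v * ?v)"
  have "degree ?v \<le> m" using Suc.prems by (simp add: degree_pderiv)
  from Suc.IH[OF this, of "d + 2"]
  have "2 * real (d + 2) * chi_sq_expect (d + 4) (pderiv ?v * pderiv ?v)
          \<le> real m * chi_sq_expect (d + 2) (?v * ?v)"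
    by (simp add: numeral_eq_Suc)
  from laguerre_raise_square_le[OF this]
  have w: "chi_sq_expect d (?w * ?w) \<le> real (Suc m) * N"
    by (simp add: N_def algebra_simps)
  \<comment> \<open>If \<open>q\<close> were an eigenvector for the largest eigenvalue \<open>m + 1\<close>, this residual would vanish.\<close>
  let ?r = "smult (real (Suc m)) q + smult (- 1) ?w"
  have "chi_sq_expect d (?r * ?r) = (real (Suc m))\<^sup>2 * chi_sq_expect d (q * q)
      - 2 * real (Suc m) * N + chi_sq_expect d (?w * ?w)"
    unfolding linear_combination_square chi_sq_expect_add chi_sq_expect_smult
      laguerre_raise_adjoint[of d q] N_def by (simp del: of_nat_Suc)
  with w chi_sq_expect_square_nonneg[of d ?r]
  have "real (Suc m) * N \<le> real (Suc m) * (real (Suc m) * chi_sq_expect d (q * q))"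
    by (simp add: power2_eq_square algebra_simps)
  then have "N \<le> real (Suc m) * chi_sq_expect d (q * q)"
    by (rule mult_left_le_imp_le) simp
  then show ?case by (simp add: N_def)
qed

text \<open>
  Nonnegativity comes from the integral; for strictness, the inequality for the derivative descends to a
  constant polynomial, so that no statement about null sets is involved.
\<close>
lemma chi_sq_expect_square_pos:
  assumes "d \<ge> 1" "q \<noteq> 0"
  shows "0 < chi_sq_expect d (q * q)"
  using assms
proof (induction "degree q" arbitrary: q d rule: less_induct)
  case less
  show ?case
  proof (cases "degree q = 0")
    case True
    then obtain c where "q = [:c:]" by (rule degree_eq_zeroE)
    with less.prems show ?thesis by (auto simp: zero_less_mult_iff linorder_neq_iff)
  next
    case False
    then have "pderiv q \<noteq> 0" "degree (pderiv q) < degree q"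
      by (auto simp: pderiv_eq_0_iff degree_pderiv)
    then have "0 < 2 * real d * chi_sq_expect (d + 2) (pderiv q * pderiv q)"
      using less.prems less.hyps[of "pderiv q" "d + 2"] by simp
    also have "\<dots> \<le> real (degree q) * chi_sq_expect d (q * q)"
      by (rule chi_sq_expect_pderiv_square_le) simp
    finally show ?thesis by (simp add: zero_less_mult_iff False)
  qed
qed

text \<open>
  The form \<open>E (t * q\<^sup>2)\<close> is almost \<open>d * E (q\<^sup>2)\<close>: the error is the cross term \<open>4 * E (t * q * q')\<close>,
  which is split by the arithmetic-geometric inequality with weight \<open>\<eta>\<close> into a small multiple of
  \<open>E (t * q\<^sup>2)\<close> and a multiple of \<open>E (t * q'\<^sup>2)\<close>, controlled by the degree of \<open>q\<close>.
\<close>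
lemma chi_sq_expect_shifted_square_pos:
  assumes d: "d \<ge> 1" and q: "q \<noteq> 0" and \<eta>: "\<eta> > 0"
    and T: "T < (real d - 2 * real (degree q) / \<eta>) / (1 + \<eta>)"
  shows "0 < chi_sq_expect d ([:-T, 1:] * (q * q))"
proof -
  define B where "B = chi_sq_expect d (q * q)"
  define X where "X = real d * chi_sq_expect (d + 2) (q * q)"
  define Y where "Y = real d * chi_sq_expect (d + 2) (q * pderiv q)"
  define Z where "Z = real d * chi_sq_expect (d + 2) (pderiv q * pderiv q)"
  have "B > 0" unfolding B_def by (rule chi_sq_expect_square_pos[OF d q])
  have "X = real d * B + 4 * Y"
    unfolding X_def Y_def B_def
    unfolding chi_sq_expect_by_parts[of d "q * q"] pderiv_mult chi_sq_expect_add
    by (simp add: distrib_left)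
  moreover have "2 * Z \<le> real (degree q) * B"
    unfolding Z_def B_def using chi_sq_expect_pderiv_square_le[of q "degree q" d] by simp
  moreover have "0 \<le> \<eta>\<^sup>2 * X + 4 * \<eta> * Y + 4 * Z"
  proof -
    \<comment> \<open>The square behind \<open>- 4 * q * q' \<le> \<eta> * q\<^sup>2 + 4 * q'\<^sup>2 / \<eta>\<close>.\<close>
    let ?r = "smult \<eta> q + smult 2 (pderiv q)"
    have "real d * chi_sq_expect (d + 2) (?r * ?r) = \<eta>\<^sup>2 * X + 4 * \<eta> * Y + 4 * Z"
      unfolding linear_combination_square chi_sq_expect_add chi_sq_expect_smult X_def Y_def Z_def
      by (simp add: distrib_left)
    then show ?thesis
      using chi_sq_expect_square_nonneg[of "d + 2" ?r] by (metis mult_nonneg_nonneg of_nat_0_le_iff)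
  qed
  ultimately have "\<eta> * (real d * B) \<le> \<eta> * X + \<eta>\<^sup>2 * X + 2 * (real (degree q) * B)"
    by (simp add: algebra_simps)
  moreover have "T * (1 + \<eta>) < real d - 2 * real (degree q) / \<eta>"
    using T \<eta> by (simp add: pos_less_divide_eq)
  then have "T * (1 + \<eta>) * \<eta> < real d * \<eta> - 2 * real (degree q)"
    using \<eta> by (simp add: field_simps)
  then have "T * (1 + \<eta>) * \<eta> * B < (real d * \<eta> - 2 * real (degree q)) * B"
    using \<open>B > 0\<close> by simp
  ultimately have "(1 + \<eta>) * \<eta> * (T * B) < (1 + \<eta>) * \<eta> * X"
    by (simp add: algebra_simps power2_eq_square)
  then have "T * B < X"
    using \<eta> by (simp add: mult_less_cancel_left)
  then show ?thesis
    by (simp add: B_def X_def chi_sq_expect_diff chi_sq_expect_add chi_sq_expect_smult)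
qed

section \<open>Polynomials nonnegative on a half-line\<close>

text \<open>
  The index bounds the degree of every summand. This has to be part of the certificate,
  because the lower bound for the expectation of a summand gets worse with its degree.
\<close>

inductive halfline_sos :: "real \<Rightarrow> nat \<Rightarrow> real poly \<Rightarrow> bool" for T where
  square: "2 * degree g \<le> n \<Longrightarrow> halfline_sos T n (g * g)"
| shifted_square: "2 * degree g + 1 \<le> n \<Longrightarrow> halfline_sos T n ([:-T, 1:] * (g * g))"
| add: "halfline_sos T n p \<Longrightarrow> halfline_sos T n q \<Longrightarrow> halfline_sos T n (p + q)"

lemma halfline_sos_smult:
  assumes "halfline_sos T n p" "c \<ge> 0"
  shows "halfline_sos T n (smult c p)"
  using assms(1)
proof induction
  case (square g n)
  have "halfline_sos T n (smult (sqrt c) g * smult (sqrt c) g)"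
    using square degree_smult_le[of "sqrt c" g] by (intro halfline_sos.square) linarith
  with assms(2) show ?case by simp
next
  case (shifted_square g n)
  have "halfline_sos T n ([:-T, 1:] * (smult (sqrt c) g * smult (sqrt c) g))"
    using shifted_square degree_smult_le[of "sqrt c" g]
    by (intro halfline_sos.shifted_square) linarith
  with assms(2) show ?case
    by (simp add: mult_smult_right del: mult_pCons_left)
next
  case (add n p q)
  then show ?case by (simp add: smult_add_right halfline_sos.add)
qed

text \<open>
  The factor is \<open>(t - T) + (T - r)\<close> with a nonnegative constant, and \<open>(t - T)\<close> turns the two
  types of summands into each other.
\<close>
lemma halfline_sos_mult_linear:
  assumes "halfline_sos T n p" "r \<le> T"
  shows "halfline_sos T (Suc n) ([:-r, 1:] * p)"
  using assms(1)
proof induction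
  case (square g n)
  have "[:-r, 1:] * (g * g) = [:-T, 1:] * (g * g) + smult (T - r) (g * g)"
    by (subst poly_eq_poly_eq_iff[symmetric], intro ext) (simp add: algebra_simps)
  moreover have "halfline_sos T (Suc n) \<dots>"
    using square assms(2)
    by (intro halfline_sos.add halfline_sos_smult halfline_sos.square halfline_sos.shifted_square)
       auto
  ultimately show ?case by metis
next
  case (shifted_square g n)
  let ?h = "[:-T, 1:] * g"
  have "[:-r, 1:] * ([:-T, 1:] * (g * g)) = ?h * ?h + smult (T - r) ([:-T, 1:] * (g * g))"
    by (subst poly_eq_poly_eq_iff[symmetric], intro ext) (simp add: algebra_simps)
  moreover have "2 * degree ?h \<le> Suc n"
    using shifted_square degree_mult_le[of "[:-T, 1:]" g] by (simp del: mult_pCons_left)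
  then have "halfline_sos T (Suc n) (?h * ?h + smult (T - r) ([:-T, 1:] * (g * g)))"
    using shifted_square assms(2)
    by (intro halfline_sos.add halfline_sos_smult halfline_sos.shifted_square halfline_sos.square) auto
  ultimately show ?case by metis
next
  case (add n p q)
  then show ?case by (simp add: distrib_left halfline_sos.add del: mult_pCons_left)
qed

lemma halfline_sos_mult_square:
  assumes "halfline_sos T n p" "degree h \<le> 1"
  shows "halfline_sos T (Suc (Suc n)) ((h * h) * p)"
  using assms(1)
proof induction
  case (square g n)
  have "halfline_sos T (Suc (Suc n)) ((h * g) * (h * g))"
    using square assms(2) degree_mult_le[of h g] by (intro halfline_sos.square) linarith
  then show ?case by (simp add: mult_ac)
next
  case (shifted_square g n)
  have "halfline_sos T (Suc (Suc n)) ([:-T, 1:] * ((h * g) * (h * g)))"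
    using shifted_square assms(2) degree_mult_le[of h g]
    by (intro halfline_sos.shifted_square) linarith
  moreover have "[:-T, 1:] * ((h * g) * (h * g)) = (h * h) * ([:-T, 1:] * (g * g))"
    by (simp only: mult_ac)
  ultimately show ?case by metis
next
  case (add n p q)
  then show ?case by (simp add: distrib_left halfline_sos.add)
qed

lemma poly_nonneg_at_left_end:
  fixes q :: "real poly"
  assumes "\<And>t. t > r \<Longrightarrow> poly q t \<ge> 0"
  shows "poly q r \<ge> 0"
proof (rule tendsto_lowerbound)
  show "(poly q \<longlongrightarrow> poly q r) (at_right r)"
    by (intro tendsto_poly tendsto_ident_at)
  show "\<forall>\<^sub>F t in at_right r. 0 \<le> poly q t"
    using assms by (auto simp: eventually_at_right_field intro: exI[of _ "r + 1"])
qed simp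

lemma poly_nonpos_at_right_end:
  fixes q :: "real poly"
  assumes "T < r" "\<And>t. T < t \<Longrightarrow> t < r \<Longrightarrow> poly q t \<le> 0"
  shows "poly q r \<le> 0"
proof (rule tendsto_upperbound)
  show "(poly q \<longlongrightarrow> poly q r) (at_left r)"
    by (intro tendsto_poly tendsto_ident_at)
  show "\<forall>\<^sub>F t in at_left r. poly q t \<le> 0"
    using assms by (auto simp: eventually_at_left_field)
qed simp

lemma poly_map_poly_of_real:
  "poly (map_poly complex_of_real p) (complex_of_real t) = complex_of_real (poly p t)"
  by (induction p) (auto simp: map_poly_pCons)

text \<open>
  The remainder of the division is real and linear and has a root off the real axis, so it is zero. The
  divisor, the minimal polynomial of \<open>z\<close>, is written as a sum of two squares for use in
  \<open>halfline_sos_of_nonneg\<close>.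
\<close>
lemma quadratic_dvd_of_complex_root:
  fixes p :: "real poly"
  assumes root: "poly (map_poly complex_of_real p) z = 0" and z: "Im z \<noteq> 0"
  shows "[:- Re z, 1:] * [:- Re z, 1:] + [:Im z:] * [:Im z:] dvd p" (is "?Q dvd p")
proof -
  have Q: "?Q = [:(Re z)\<^sup>2 + (Im z)\<^sup>2, - 2 * Re z, 1:]"
    by (simp add: power2_eq_square)
  have hom: "poly (map_poly complex_of_real (a * b + c)) z
      = poly (map_poly complex_of_real a) z * poly (map_poly complex_of_real b) z
        + poly (map_poly complex_of_real c) z" for a b c
  proof -
    have "map_poly complex_of_real (a * b + c)
        = map_poly complex_of_real a * map_poly complex_of_real b + map_poly complex_of_real c"
      by (rule poly_eqI) (simp add: coeff_map_poly coeff_mult)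
    then show ?thesis by simp
  qed
  have "z * z = complex_of_real (2 * Re z) * z - complex_of_real ((Re z)\<^sup>2 + (Im z)\<^sup>2)"
    by (simp add: complex_eq_iff power2_eq_square)
  then have Qz: "poly (map_poly complex_of_real ?Q) z = 0"
    unfolding Q by (simp add: map_poly_pCons algebra_simps)
  have "degree ?Q = 2" unfolding Q by simp
  then have "?Q \<noteq> 0" by auto
  define R where "R = p mod ?Q"
  have "degree R \<le> 1"
    using degree_mod_less[OF \<open>?Q \<noteq> 0\<close>, of p] \<open>degree ?Q = 2\<close> by (auto simp: R_def)
  have R: "R = [:coeff R 0, coeff R 1:]"
  proof (rule poly_eqI)
    fix i
    show "coeff R i = coeff [:coeff R 0, coeff R 1:] i"
      using \<open>degree R \<le> 1\<close> coeff_eq_0[of R i]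
      by (cases i; cases "i - 1") (auto simp: coeff_pCons split: nat.splits)
  qed
  have "p = (p div ?Q) * ?Q + R"
    unfolding R_def by (rule div_mult_mod_eq[symmetric])
  with root hom[of "p div ?Q" ?Q R] Qz have "poly (map_poly complex_of_real R) z = 0"
    by simp
  then have "complex_of_real (coeff R 0) + z * complex_of_real (coeff R 1) = 0"
    by (subst (asm) R) (simp add: map_poly_pCons)
  then have "coeff R 1 = 0 \<and> coeff R 0 = 0"
    using z by (auto simp: complex_eq_iff)
  with R have "R = 0" by (metis pCons_0_0)
  then show ?thesis by (simp add: R_def mod_eq_0_iff_dvd)
qed

text \<open>
  Split off one root, or one pair of roots, at a time: a root at or left of \<open>T\<close> contributes a
  linear factor, a root right of \<open>T\<close> is at least double since there is no sign change, and a pair of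
  non-real roots contributes a sum of two squares. The cofactor is again nonnegative on the half-line, by
  continuity at the removed root.
\<close>
lemma halfline_sos_of_nonneg:
  assumes "\<And>t. t \<ge> T \<Longrightarrow> poly p t \<ge> 0"
  shows "halfline_sos T (degree p) p"
  using assms
proof (induction "degree p" arbitrary: p rule: less_induct)
  case less
  show ?case
  proof (cases "degree p = 0")
    case True
    then obtain c where c: "p = [:c:]" by (rule degree_eq_zeroE)
    with less.prems[of T] have "c \<ge> 0" by simp
    then have "p = [:sqrt c:] * [:sqrt c:]" by (simp add: c)
    then show ?thesis using halfline_sos.square[of "[:sqrt c:]" "degree p" T] by simp
  next
    case False
    then have p0: "p \<noteq> 0" by auto
    have "degree (map_poly complex_of_real p) > 0"
      using False by (simp add: degree_map_poly)
    then obtain z where z: "poly (map_poly complex_of_real p) z = 0"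
      using alg_closed_imp_poly_has_root by blast
    show ?thesis
    proof (cases "Im z = 0")
      case True
      define r where "r = Re z"
      have "z = complex_of_real r" using True by (simp add: r_def complex_eq_iff)
      with z have "poly p r = 0"
        by (metis of_real_eq_0_iff poly_map_poly_of_real)
      then obtain q where q: "p = [:-r, 1:] * q"
        by (auto simp: poly_eq_0_iff_dvd simp del: mult_pCons_left)
      with p0 have q0: "q \<noteq> 0" by auto
      have dp: "degree p = Suc (degree q)"
        unfolding q using q0 by (subst degree_mult_eq) auto
      have pt: "poly p t = (t - r) * poly q t" for t
        by (simp add: q algebra_simps)
      have qr: "poly q t \<ge> 0" if "t > r" "t \<ge> T" for t
        using less.prems[of t] that by (simp add: pt zero_le_mult_iff)
      show ?thesis
      proof (cases "r \<le> T")
        case True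
        have "poly q t \<ge> 0" if "t \<ge> T" for t
          by (rule poly_nonneg_at_left_end) (use that True qr in auto)
        then have "halfline_sos T (degree q) q" using less.hyps dp by simp
        from halfline_sos_mult_linear[OF this True] show ?thesis
          by (simp only: dp q[symmetric])
      next
        case False
        have "poly q r \<ge> 0"
          by (rule poly_nonneg_at_left_end) (use False qr in auto)
        moreover have "poly q r \<le> 0"
        proof (rule poly_nonpos_at_right_end)
          show "T < r" using False by simp
          fix t assume "T < t" "t < r"
          then show "poly q t \<le> 0" using less.prems[of t] by (simp add: pt zero_le_mult_iff)
        qed
        ultimately have "poly q r = 0" by simp
        then obtain q2 where q2: "q = [:-r, 1:] * q2"
          by (auto simp: poly_eq_0_iff_dvd simp del: mult_pCons_left)
        with q0 have "q2 \<noteq> 0" by auto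
        then have dq: "degree q = Suc (degree q2)"
          unfolding q2 by (subst degree_mult_eq) auto
        have pt2: "poly p t = (t - r)\<^sup>2 * poly q2 t" for t
          by (simp add: pt q2 power2_eq_square algebra_simps)
        have *: "poly q2 t \<ge> 0" if "t \<ge> T" "t \<noteq> r" for t
          using less.prems[of t] that by (simp add: pt2 zero_le_mult_iff)
        have "poly q2 r \<ge> 0"
          by (rule poly_nonneg_at_left_end) (use False * in auto)
        with * have "poly q2 t \<ge> 0" if "t \<ge> T" for t
          using that by (cases "t = r") auto
        then have "halfline_sos T (degree q2) q2" using less.hyps dp dq by simp
        from halfline_sos_mult_square[OF this, of "[:-r, 1:]"]
        have "halfline_sos T (degree p) (([:-r, 1:] * [:-r, 1:]) * q2)"
          by (simp only: dp dq) simp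
        moreover have "([:-r, 1:] * [:-r, 1:]) * q2 = p"
          unfolding q q2 by (simp only: mult.assoc)
        ultimately show ?thesis by metis
      qed
    next
      case False
      let ?h = "[:- Re z, 1:]" and ?b = "[:Im z:]"
      obtain q where q: "p = (?h * ?h + ?b * ?b) * q"
        using quadratic_dvd_of_complex_root[OF z False] by (elim dvdE)
      with p0 have q0: "q \<noteq> 0" by auto
      have dQ: "degree (?h * ?h + ?b * ?b) = 2" by simp
      then have dp: "degree p = Suc (Suc (degree q))"
        unfolding q using q0 by (subst degree_mult_eq) auto
      have pt: "poly p t = ((t - Re z)\<^sup>2 + (Im z)\<^sup>2) * poly q t" for t
        by (simp add: q power2_eq_square algebra_simps)
      have "(t - Re z)\<^sup>2 + (Im z)\<^sup>2 > 0" for t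
        using False by (simp add: add_nonneg_pos)
      then have "poly q t \<ge> 0" if "t \<ge> T" for t
        using less.prems[OF that] unfolding pt by (simp add: zero_le_mult_iff not_le[symmetric])
      then have *: "halfline_sos T (degree q) q" using less.hyps dp by simp
      have "halfline_sos T (degree p) ((?h * ?h) * q + (?b * ?b) * q)"
        unfolding dp by (intro halfline_sos.add halfline_sos_mult_square *) auto
      then show ?thesis
        unfolding q by (simp only: distrib_right)
    qed
  qed
qed

section \<open>The two bounds\<close>

lemma chi_sq_expect_pos:
  assumes "halfline_sos T n p" "p \<noteq> 0" and d: "d \<ge> 1" and \<eta>: "\<eta> > 0"
    and "T < (real d - real n / \<eta>) / (1 + \<eta>)"
  shows "0 < chi_sq_expect d p"
proof -
  have "p = 0 \<or> 0 < chi_sq_expect d p"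
    using assms(1,5)
  proof induction
    case (square g n)
    then show ?case using chi_sq_expect_square_pos[OF d, of g] by auto
  next
    case (shifted_square g n)
    show ?case
    proof (cases "g = 0")
      case False
      have "2 * real (degree g) / \<eta> \<le> real n / \<eta>"
        using shifted_square.hyps \<eta> by (intro divide_right_mono) auto
      then have "(real d - real n / \<eta>) / (1 + \<eta>) \<le> (real d - 2 * real (degree g) / \<eta>) / (1 + \<eta>)"
        using \<eta> by (intro divide_right_mono) auto
      with shifted_square.prems chi_sq_expect_shifted_square_pos[OF d False \<eta>, of T]
      show ?thesis by linarith
    qed simp
  next
    case (add n p q)
    then show ?case by (auto simp: chi_sq_expect_add)
  qed
  with assms(2) show ?thesis by simp
qed

lemma ex_sq_radius:
  assumes "d \<ge> 1" "t \<ge> 0"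
  obtains x where "x \<in> Rd d" "sq_radius d x = t"
proof
  let ?x = "\<lambda>i\<in>{..<d}. if i = 0 then sqrt (t / (2 * pi)) else 0"
  show "?x \<in> Rd d" by (simp add: Rd_def)
  have "sq_radius d ?x = (\<Sum>i<d. if i = 0 then t else 0)"
    using assms(2) unfolding sq_radius_sum by (intro sum.cong) auto
  also have "\<dots> = t" using assms(1) by simp
  finally show "sq_radius d ?x = t" .
qed

lemma gaussian_exponent: "- pi * (norm_Rd d x)\<^sup>2 = - sq_radius d x / 2"
  by (simp add: sq_radius_def)

lemma norm_Rd_ge_iff:
  assumes "\<rho> \<ge> 0"
  shows "\<rho> \<le> norm_Rd d x \<longleftrightarrow> 2 * pi * \<rho>\<^sup>2 \<le> sq_radius d x"
proof -
  have "norm_Rd d x \<ge> 0" by (simp add: norm_Rd_def)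
  with assms show ?thesis by (simp add: sq_radius_def)
qed

text \<open>
  At the origin the eigenfunction equation and \<open>f(0) = 0\<close> say that the expectation of the polynomial
  is zero, whereas its sign beyond \<open>2 * pi * \<rho>\<^sup>2\<close> would make it positive if \<open>\<rho>\<close> were smaller.
\<close>
lemma sign_admissible_lower_bound:
  assumes d: "d \<ge> 1" and \<rho>: "\<rho> \<ge> 0" and f: "sign_admissible d s n \<rho> f" and \<eta>: "\<eta> > 0"
  shows "(real d - real n / \<eta>) / (1 + \<eta>) \<le> 2 * pi * \<rho>\<^sup>2"
proof (rule ccontr)
  assume "\<not> ?thesis"
  then have T: "2 * pi * \<rho>\<^sup>2 < (real d - real n / \<eta>) / (1 + \<eta>)" by simp
  obtain p where deg: "degree p \<le> n"
    and fp: "\<And>x. x \<in> Rd d \<Longrightarrow> f x = poly p (sq_radius d x) * exp (- sq_radius d x / 2)"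
    using f unfolding sign_admissible_def poly_gaussian_def gaussian_exponent
    by (auto simp: sq_radius_def)
  have "p \<noteq> 0" using f fp by (auto simp: sign_admissible_def)
  have "poly p t \<ge> 0" if "t \<ge> 2 * pi * \<rho>\<^sup>2" for t
  proof -
    have "t \<ge> 0" using that by (rule order_trans[rotated]) simp
    then obtain x where x: "x \<in> Rd d" "sq_radius d x = t" using ex_sq_radius[OF d] by blast
    with that f have "f x \<ge> 0" by (auto simp: sign_admissible_def norm_Rd_ge_iff[OF \<rho>])
    with fp[OF x(1)] x(2) show ?thesis by (simp add: zero_le_mult_iff)
  qed
  then have "halfline_sos (2 * pi * \<rho>\<^sup>2) (degree p) p" by (rule halfline_sos_of_nonneg)
  moreover have "(real d - real n / \<eta>) / (1 + \<eta>) \<le> (real d - real (degree p) / \<eta>) / (1 + \<eta>)"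
    using deg \<eta> by (intro divide_right_mono diff_left_mono) auto
  ultimately have pos: "0 < chi_sq_expect d p"
    using T by (intro chi_sq_expect_pos[OF _ \<open>p \<noteq> 0\<close> d \<eta>, of _ "degree p"]) auto
  let ?o = "\<lambda>i\<in>{..<d}. 0 :: real"
  have "complex_of_real (chi_sq_expect d p)
      = fourier d (\<lambda>x. complex_of_real (poly p (sq_radius d x) * exp (- sq_radius d x / 2))) ?o"
    by (rule fourier_poly_gaussian_origin[symmetric]) simp
  also have "\<dots> = fourier d (\<lambda>x. complex_of_real (f x)) ?o"
    unfolding fourier_def
    by (intro Bochner_Integration.integral_cong refl) (simp only: space_lborel_Rd fp)
  also have "\<dots> = complex_of_real (s * f ?o)"
    using f by (auto simp: sign_admissible_def Rd_def)
  also have "\<dots> = 0" using f by (simp add: sign_admissible_def)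
  finally show False using pos by simp
qed

text \<open>
  With \<open>L\<^sub>k\<close> the Laguerre polynomial with parameter \<open>d / 2 - 1\<close>, these are positive multiples
  of \<open>L\<^sub>2 - L\<^sub>2(0)\<close> and of \<open>(L\<^sub>3(0) / L\<^sub>1(0)) * L\<^sub>1 - L\<^sub>3\<close>.
\<close>
definition extremal_poly :: "nat \<Rightarrow> real \<Rightarrow> real poly" where
  "extremal_poly d s = (if s = 1 then [:0, - (real d + 2), 1:]
     else [:0, (real d + 2) * (real d + 4) / 2, - (3 / 2) * (real d + 4), 1:])"

text \<open>
  The cubic is expanded around \<open>d + 6\<close>, the bound for the largest root that is used for both signs, so
  that its sign beyond that point can be read off.
\<close>
lemma poly_extremal_poly:
  "poly (extremal_poly d s) t = (if s = 1 then t * (t - (real d + 2))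
     else t * ((t - (real d + 6)) * (t - real d / 2) + 4))"
  by (simp add: extremal_poly_def field_simps)

lemma extremal_poly_eigen:
  assumes "s \<in> {1, -1}"
  shows "(\<Sum>k\<le>degree (extremal_poly d s). coeff (extremal_poly d s) k * poly (gauss_transform d k) u)
           = s * poly (extremal_poly d s) u"
proof (cases "s = 1")
  case True
  then show ?thesis
    by (simp add: extremal_poly_def numeral_eq_Suc pderiv_pCons algebra_simps)
next
  case False
  with assms have "s = -1" by simp
  then show ?thesis
    by (simp add: extremal_poly_def numeral_eq_Suc pderiv_pCons field_simps)
qed

lemma sign_admissible_extremal:
  assumes d: "d \<ge> 1" and n: "n \<ge> 3" and s: "s \<in> {1, -1}"
  shows "sign_admissible d s n (sqrt ((real d + 6) / (2 * pi)))
    (\<lambda>x. poly (extremal_poly d s) (sq_radius d x) * exp (- sq_radius d x / 2))"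
    (is "sign_admissible d s n ?\<rho> ?f")
  unfolding sign_admissible_def
proof (intro conjI ballI impI)
  have "degree (extremal_poly d s) \<le> n"
    using n by (simp add: extremal_poly_def)
  then show "poly_gaussian d n ?f"
    unfolding poly_gaussian_def gaussian_exponent by (auto simp: sq_radius_def)
  obtain x where "x \<in> Rd d" "sq_radius d x = real d + 6"
    using ex_sq_radius[OF d, of "real d + 6"] by auto
  then show "\<exists>x\<in>Rd d. ?f x \<noteq> 0"
    by (auto intro!: bexI[of _ x] simp: poly_extremal_poly)
  show "fourier d (\<lambda>x. complex_of_real (?f x)) y = complex_of_real (s * ?f y)" for y
    unfolding fourier_poly_gaussian extremal_poly_eigen[OF s] by (simp only: mult.assoc)
  show "?f (\<lambda>i\<in>{..<d}. 0) = 0"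
    by (simp add: sq_radius_sum poly_extremal_poly)
  fix x assume "?\<rho> \<le> norm_Rd d x"
  then have "2 * pi * ?\<rho>\<^sup>2 \<le> sq_radius d x" by (subst (asm) norm_Rd_ge_iff) auto
  then have "real d + 6 \<le> sq_radius d x" by simp
  then show "0 \<le> ?f x" by (auto simp: poly_extremal_poly)
qed

lemma rho_bounds:
  assumes d: "d \<ge> 1" and n: "n \<ge> 3" and s: "s \<in> {1, -1}" and \<eta>: "\<eta> > 0"
  shows "rho d s n \<le> sqrt ((real d + 6) / (2 * pi))"
    and "sqrt ((real d - real n / \<eta>) / (1 + \<eta>) / (2 * pi)) \<le> rho d s n"
proof -
  let ?A = "{\<rho>. \<rho> \<ge> 0 \<and> (\<exists>f. sign_admissible d s n \<rho> f)}"
  have mem: "sqrt ((real d + 6) / (2 * pi)) \<in> ?A"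
    using sign_admissible_extremal[OF d n s] by auto
  then show "rho d s n \<le> sqrt ((real d + 6) / (2 * pi))"
    unfolding rho_def by (intro cInf_lower bdd_belowI[of _ 0]) auto
  show "sqrt ((real d - real n / \<eta>) / (1 + \<eta>) / (2 * pi)) \<le> rho d s n"
    unfolding rho_def
  proof (rule cInf_greatest)
    show "?A \<noteq> {}" using mem by blast
    fix \<rho> assume "\<rho> \<in> ?A"
    then have "\<rho> \<ge> 0" "(real d - real n / \<eta>) / (1 + \<eta>) \<le> 2 * pi * \<rho>\<^sup>2"
      using sign_admissible_lower_bound[OF d _ _ \<eta>] by auto
    then have "(real d - real n / \<eta>) / (1 + \<eta>) / (2 * pi) \<le> \<rho>\<^sup>2"
      by (subst pos_divide_le_eq) (simp_all only: mult.commute pi_gt_zero zero_less_mult_iff, simp)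
    with \<open>\<rho> \<ge> 0\<close> show "sqrt ((real d - real n / \<eta>) / (1 + \<eta>) / (2 * pi)) \<le> \<rho>"
      by (intro real_le_lsqrt)
  qed
qed

theorem theorem1p2:
  fixes s :: real and n :: "nat \<Rightarrow> nat"
  assumes "s \<in> {1, -1}"
    and "\<forall>d\<ge>1. n d \<ge> 3"
    and "(\<lambda>d. real (n d) / real d) \<longlonglongrightarrow> 0"
  shows "(\<lambda>d. rho d s (n d) / sqrt (real d / (2 * pi))) \<longlonglongrightarrow> 1"
proof (rule tendsto_sandwich)
  \<comment> \<open>This choice balances the two losses \<open>\<eta>\<close> and \<open>n / (d * \<eta>)\<close> of the lower bound.\<close>
  define \<eta> where "\<eta> d = sqrt (real (n d) / real d)" for d
  have \<eta>_pos: "\<eta> d > 0" if "d \<ge> 1" for d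
    using that assms(2)[rule_format, OF that] by (simp add: \<eta>_def)
  have "\<eta> \<longlonglongrightarrow> 0"
    using tendsto_real_sqrt[OF assms(3)] by (simp add: \<eta>_def[abs_def])
  then have "(\<lambda>d. sqrt ((1 - \<eta> d) / (1 + \<eta> d))) \<longlonglongrightarrow> sqrt ((1 - 0) / (1 + 0))"
    by (intro tendsto_intros) auto
  then show "(\<lambda>d. sqrt ((1 - \<eta> d) / (1 + \<eta> d))) \<longlonglongrightarrow> 1" by simp
  show "\<forall>\<^sub>F d in sequentially. sqrt ((1 - \<eta> d) / (1 + \<eta> d)) \<le> rho d s (n d) / sqrt (real d / (2 * pi))"
    using eventually_ge_at_top[of 1]
  proof eventually_elim
    case (elim d)
    have "real (n d) = \<eta> d * (\<eta> d * real d)"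
      using elim by (simp add: \<eta>_def flip: mult.assoc)
    then have "real (n d) / \<eta> d = \<eta> d * real d"
      using \<eta>_pos[OF elim] by simp
    then have "(real d - real (n d) / \<eta> d) / (1 + \<eta> d) / (2 * pi)
        = (1 - \<eta> d) / (1 + \<eta> d) * (real d / (2 * pi))"
      by (simp add: algebra_simps)
    with rho_bounds(2)[OF elim assms(2)[rule_format, OF elim] assms(1) \<eta>_pos[OF elim]]
    have "sqrt ((1 - \<eta> d) / (1 + \<eta> d)) * sqrt (real d / (2 * pi)) \<le> rho d s (n d)"
      by (simp only: real_sqrt_mult)
    then show ?case
      using elim by (subst pos_le_divide_eq) auto
  qed
  show "\<forall>\<^sub>F d in sequentially. rho d s (n d) / sqrt (real d / (2 * pi)) \<le> sqrt (1 + 6 / real d)"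
    using eventually_ge_at_top[of 1]
  proof eventually_elim
    case (elim d)
    have "(real d + 6) / (2 * pi) = (1 + 6 / real d) * (real d / (2 * pi))"
      using elim by (simp add: field_simps)
    with rho_bounds(1)[OF elim assms(2)[rule_format, OF elim] assms(1) \<eta>_pos[OF elim]]
    have "rho d s (n d) \<le> sqrt (1 + 6 / real d) * sqrt (real d / (2 * pi))"
      by (simp only: real_sqrt_mult)
    then show ?case
      using elim by (subst pos_divide_le_eq) auto
  qed
  have "(\<lambda>d. sqrt (1 + 6 / real d)) \<longlonglongrightarrow> sqrt (1 + 0)"
    by (intro tendsto_intros lim_const_over_n)
  then show "(\<lambda>d. sqrt (1 + 6 / real d)) \<longlonglongrightarrow> 1" by simp
qed

end
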